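(* There is a constant $C>0$ such that for every integer $d\ge 1$ and every unit vector $|\psi\rangle\in\mathcal{H}^d\otimes\mathcal{H}^d$ there exists a local hidden variable protocol with classical communication such that, for every pair $(\hat A,\hat B)$ of traceless binary observables on $\mathcal{H}^d$ given as inputs to Alice and Bob respectively, the following two properties hold. (i) The outputs $A,B\in\{1,-1\}$ of Alice and Bob satisfy $E(AB\mid \hat A\otimes\hat B)=\langle\psi|\hat A\otimes\hat B|\psi\rangle$ exactly, i.e. the protocol simulates the joint quantum correlations of measuring $|\psi\rangle$ according to $\hat A$ and $\hat B$. (ii) The expected number of bits communicated is at most $\log(d)+C$.
   Context: $\mathcal{H}^d$ denotes the complex Hilbert space of dimension $d$, and $\log$ is the logarithm in base 2. Traceless binary observable (TBO): a Hermitian operator $\hat A$ on $\mathcal{H}^d$ with $\mathrm{Tr}(\hat A)=0$ and $\hat A^2=\mathbb{1}$ (so the measurement outcomes are $1$ and $-1$). Quantum experiment: Alice and Bob share $|\psi\rangle\in\mathcal{H}^d\otimes\mathcal{H}^d$. Alice measures the TBO $\hat A$ on the first factor and Bob measures the TBO $\hat B$ on the second factor, with outcomes $A,B\in\{1,-1\}$. The joint quantum correlation is the expectation of the product of the outcomes, $E(AB\mid\hat A\otimes\hat B)=\langle\psi|\hat A\otimes\hat B|\psi\rangle$. Local hidden variable protocol with classical communication: Alice and Bob share a random variable (of arbitrary, possibly infinite, size) whose distribution does not depend on the inputs. Alice receives only $\hat A$ and Bob receives only $\hat B$; both know $d$ and $|\psi\rangle$, and the protocol may depend on these. They exchange classical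 bits. Each transmitted bit is a function of the sender's input, the shared random variable, and the bits exchanged so far; which party speaks next, and whether communication has ended, is determined by the bits exchanged so far (for instance, a single message encoded with a prefix-free binary code). Communication ends with probability 1. Then Alice outputs $A\in\{1,-1\}$ as a function of $\hat A$, the shared random variable and the exchanged bits, and Bob outputs $B\in\{1,-1\}$ as a function of $\hat B$, the shared random variable and the exchanged bits. Expectations (of $AB$ and of the number of bits) are over the shared randomness, for fixed inputs. *)

theory Defs
  imports "HOL-Probability.Probability" "Jordan_Normal_Form.Schur_Decomposition"
begin

section \<open>Operators and states\<close>

definition mat_trace :: "'a :: comm_monoid_add mat \<Rightarrow> 'a" where
  "mat_trace A = (\<Sum>i<dim_row A. A $$ (i, i))"

definition traceless_binary_observable :: "nat \<Rightarrow> complex mat \<Rightarrow> bool" where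
  "traceless_binary_observable d A \<longleftrightarrow>
     A \<in> carrier_mat d d \<and> mat_adjoint A = A \<and> mat_trace A = 0 \<and> A * A = 1\<^sub>m d"

text \<open>The tensor product of two spaces of dimensions \<open>m\<close> and \<open>n\<close> is the space of vectors of
  dimension \<open>m * n\<close>, where \<open>e\<^sub>i \<otimes> e\<^sub>j\<close> is the basis vector with index \<open>i * n + j\<close>.\<close>

definition kronecker :: "'a :: times mat \<Rightarrow> 'a mat \<Rightarrow> 'a mat" where
  "kronecker A B = mat (dim_row A * dim_row B) (dim_col A * dim_col B)
     (\<lambda>(i, j). A $$ (i div dim_row B, j div dim_col B) * B $$ (i mod dim_row B, j mod dim_col B))"

text \<open>The conjugate falls on the second argument of \<open>\<bullet>c\<close>.\<close>

definition quantum_correlation :: "complex vec \<Rightarrow> complex mat \<Rightarrow> complex mat \<Rightarrow> complex" where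
  "quantum_correlation \<psi> A B = (kronecker A B *\<^sub>v \<psi>) \<bullet>c \<psi>"

section \<open>Local hidden variable protocols with classical communication\<close>

datatype party = Alice | Bob

text \<open>\<open>turn h\<close> is the party that sends the next bit after the bits \<open>h\<close> (oldest first) have been
  exchanged, and \<open>None\<close> if the communication is over.\<close>

record ('x, 'y, 'r) lhv_protocol =
  randomness :: "'r measure"
  turn :: "bool list \<Rightarrow> party option"
  alice_bit :: "'x \<Rightarrow> 'r \<Rightarrow> bool list \<Rightarrow> bool"
  bob_bit :: "'y \<Rightarrow> 'r \<Rightarrow> bool list \<Rightarrow> bool"
  alice_out :: "'x \<Rightarrow> 'r \<Rightarrow> bool list \<Rightarrow> real"
  bob_out :: "'y \<Rightarrow> 'r \<Rightarrow> bool list \<Rightarrow> real"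

primrec bits_after :: "('x, 'y, 'r) lhv_protocol \<Rightarrow> 'x \<Rightarrow> 'y \<Rightarrow> 'r \<Rightarrow> nat \<Rightarrow> bool list" where
  "bits_after P x y r 0 = []"
| "bits_after P x y r (Suc n) =
     (let h = bits_after P x y r n in
      case turn P h of
        None \<Rightarrow> h
      | Some Alice \<Rightarrow> h @ [alice_bit P x r h]
      | Some Bob \<Rightarrow> h @ [bob_bit P y r h])"

definition ends :: "('x, 'y, 'r) lhv_protocol \<Rightarrow> 'x \<Rightarrow> 'y \<Rightarrow> 'r \<Rightarrow> bool" where
  "ends P x y r \<longleftrightarrow> (\<exists>n. turn P (bits_after P x y r n) = None)"

text \<open>The next three functions are meaningful only if \<open>ends P x y r\<close> holds, which is the case
  almost surely in a valid protocol.\<close>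

definition num_bits :: "('x, 'y, 'r) lhv_protocol \<Rightarrow> 'x \<Rightarrow> 'y \<Rightarrow> 'r \<Rightarrow> nat" where
  "num_bits P x y r = (LEAST n. turn P (bits_after P x y r n) = None)"

definition alice_output :: "('x, 'y, 'r) lhv_protocol \<Rightarrow> 'x \<Rightarrow> 'y \<Rightarrow> 'r \<Rightarrow> real" where
  "alice_output P x y r = alice_out P x r (bits_after P x y r (num_bits P x y r))"

definition bob_output :: "('x, 'y, 'r) lhv_protocol \<Rightarrow> 'x \<Rightarrow> 'y \<Rightarrow> 'r \<Rightarrow> real" where
  "bob_output P x y r = bob_out P y r (bits_after P x y r (num_bits P x y r))"

text \<open>Measurability in the shared randomness, for fixed input and fixed bits exchanged, makes the
  number of bits and the outputs random variables. Without it the integrals below would not be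
  expectations.\<close>

definition valid_lhv_protocol ::
  "'x set \<Rightarrow> 'y set \<Rightarrow> ('x, 'y, 'r) lhv_protocol \<Rightarrow> bool" where
  "valid_lhv_protocol X Y P \<longleftrightarrow>
     prob_space (randomness P) \<and>
     (\<forall>x\<in>X. \<forall>h. (\<lambda>r. alice_bit P x r h) \<in> randomness P \<rightarrow>\<^sub>M count_space UNIV) \<and>
     (\<forall>y\<in>Y. \<forall>h. (\<lambda>r. bob_bit P y r h) \<in> randomness P \<rightarrow>\<^sub>M count_space UNIV) \<and>
     (\<forall>x\<in>X. \<forall>h. (\<lambda>r. alice_out P x r h) \<in> borel_measurable (randomness P)) \<and>
     (\<forall>y\<in>Y. \<forall>h. (\<lambda>r. bob_out P y r h) \<in> borel_measurable (randomness P)) \<and>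
     (\<forall>x\<in>X. \<forall>r\<in>space (randomness P). \<forall>h. alice_out P x r h \<in> {1, -1}) \<and>
     (\<forall>y\<in>Y. \<forall>r\<in>space (randomness P). \<forall>h. bob_out P y r h \<in> {1, -1}) \<and>
     (\<forall>x\<in>X. \<forall>y\<in>Y. AE r in randomness P. ends P x y r)"

definition joint_correlation :: "('x, 'y, 'r) lhv_protocol \<Rightarrow> 'x \<Rightarrow> 'y \<Rightarrow> real" where
  "joint_correlation P x y =
     (\<integral>r. alice_output P x y r * bob_output P x y r \<partial>randomness P)"

text \<open>A nonnegative integral, so that an infinite expectation is not turned into \<open>0\<close>.\<close>

definition expected_bits :: "('x, 'y, 'r) lhv_protocol \<Rightarrow> 'x \<Rightarrow> 'y \<Rightarrow> ennreal" where
  "expected_bits P x y = (\<integral>\<^sup>+r. of_nat (num_bits P x y r) \<partial>randomness P)"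

end

theory Submission
  imports Defs
begin

text \<open>
  The correlation is the inner product of the vectors \<open>u = (A \<otimes> 1) \<psi>\<close> and \<open>v = (1 \<otimes> B) \<psi>\<close>, which are
  unit vectors because \<open>A\<close> and \<open>B\<close> are Hermitian and square to \<open>1\<close>; let \<open>a\<close> and \<open>b\<close> be \<open>u\<close> and \<open>v\<close> as
  vectors of \<open>\<real>\<^sup>n\<close> with \<open>n = 2 d\<^sup>2\<close>. If \<open>g\<close> is a standard Gaussian vector then
  \<open>E (\<langle>a, g\<rangle> sign \<langle>b, g\<rangle>) = sqrt (2 / \<pi>) \<langle>a, b\<rangle>\<close>. Hence, if \<open>g\<close> has the Gaussian law reweighted by
  \<open>\<bar>\<langle>a, g\<rangle>\<bar>\<close>, the outputs \<open>sign \<langle>a, g\<rangle>\<close> and \<open>sign \<langle>b, g\<rangle>\<close> have correlation \<open>\<langle>a, b\<rangle>\<close>. Alice obtains such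
  a \<open>g\<close> by rejection sampling from a shared sequence of vectors whose law is Gaussian reweighted by
  the norm of \<open>g\<close>: she accepts \<open>g\<close> with probability \<open>\<bar>\<langle>a, g\<rangle>\<bar> / \<parallel>g\<parallel> \<le> 1\<close>, which on average is
  \<open>sqrt (2 / \<pi>) / E \<parallel>g\<parallel> \<ge> 1 / (d sqrt \<pi>)\<close>. She sends Bob the index of the first accepted vector, as
  \<open>\<lceil>log d\<rceil>\<close> low-order bits followed by the quotient in unary. The index has expectation \<open>O(d)\<close>, so
  the unary part has expected length \<open>O(1)\<close>.
\<close>

subsection \<open>Rejection sampling from an independent sequence\<close>

text \<open>If no entry lies in \<open>A\<close> the value is some unspecified natural number; for
  \<open>A\<close> of positive measure this happens with probability 0
  (\<open>AE_hit\<close>).\<close>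

definition first_hit :: "'a set \<Rightarrow> (nat \<Rightarrow> 'a) \<Rightarrow> nat" where
  "first_hit A \<omega> = (LEAST i. \<omega> i \<in> A)"

lemma ex_nat_split: "(\<exists>i. P i) \<longleftrightarrow> P 0 \<or> (\<exists>i. P (Suc i))"
  by (metis not0_implies_Suc)

context sequence_space
begin

lemma measurable_first_hit:
  assumes [measurable]: "A \<in> sets M"
  shows "first_hit A \<in> S \<rightarrow>\<^sub>M count_space UNIV"
  unfolding first_hit_def by measurable

lemma measurable_at_first_hit:
  assumes [measurable]: "A \<in> sets M" "f \<in> M \<rightarrow>\<^sub>M N"
  shows "(\<lambda>\<omega>. f (\<omega> (first_hit A \<omega>))) \<in> S \<rightarrow>\<^sub>M N"
  by (rule measurable_compose_countable[where f="\<lambda>i \<omega>. f (\<omega> i)", OF _ measurable_first_hit[OF assms(1)]])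
    measurable

lemma emeasure_no_hit:
  assumes A: "A \<in> sets M"
  shows "emeasure S {\<omega> \<in> space S. \<forall>i<k. \<omega> i \<notin> A} = ennreal ((1 - measure M A) ^ k)"
proof -
  have "{\<omega> \<in> space S. \<forall>i<k. \<omega> i \<notin> A} = {\<omega> \<in> space S. \<forall>i\<in>{..<k}. \<omega> i \<in> space M - A}"
    by (auto simp: space_PiM PiE_iff)
  also have "emeasure S \<dots> = (\<Prod>i\<in>{..<k}. emeasure M (space M - A))"
    using A by (intro emeasure_PiM_Collect) auto
  also have "\<dots> = ennreal ((1 - measure M A) ^ k)"
    using A by (simp add: M.emeasure_eq_measure M.prob_compl ennreal_power)
  finally show ?thesis .
qed

text \<open>The tail sum formula for the expectation, with each tail bounded by the probability that
  the first \<open>t\<close> entries miss \<open>A\<close>, gives a geometric series of ratio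
  \<open>1 - measure M A\<close>. The exact mean is smaller by 1.\<close>

lemma nn_integral_first_hit_le:
  assumes A: "A \<in> sets M" and p: "measure M A > 0"
  shows "(\<integral>\<^sup>+\<omega>. of_nat (first_hit A \<omega>) \<partial>S) \<le> ennreal (1 / measure M A)"
proof -
  define q where "q = 1 - measure M A"
  have q: "0 \<le> q" "q < 1" using p by (auto simp: q_def)
  have "(\<integral>\<^sup>+\<omega>. of_nat (first_hit A \<omega>) \<partial>S) = (\<Sum>t. emeasure S {\<omega> \<in> space S. t < first_hit A \<omega>})"
    using measurable_first_hit[OF A] by (rule nn_integral_nat_function)
  also have "\<dots> \<le> (\<Sum>t. ennreal (q ^ t))"
  proof (intro suminf_le summableI)
    fix t
    have "emeasure S {\<omega> \<in> space S. t < first_hit A \<omega>}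
        \<le> emeasure S {\<omega> \<in> space S. \<forall>i<t. \<omega> i \<notin> A}"
      using A by (intro emeasure_mono) (auto simp: first_hit_def dest: not_less_Least less_trans)
    then show "emeasure S {\<omega> \<in> space S. t < first_hit A \<omega>} \<le> ennreal (q ^ t)"
      by (simp add: emeasure_no_hit[OF A] q_def)
  qed
  also have "\<dots> = ennreal (\<Sum>t. q ^ t)"
    using q by (intro suminf_ennreal2) (auto intro: summable_geometric)
  also have "(\<Sum>t. q ^ t) = 1 / (1 - q)"
    using q by (intro suminf_geometric) auto
  finally show ?thesis by (simp add: q_def)
qed

lemma AE_hit:
  assumes A: "A \<in> sets M" and p: "measure M A > 0"
  shows "AE \<omega> in S. \<exists>i. \<omega> i \<in> A"
proof (rule AE_I)
  let ?Z = "{\<omega> \<in> space S. \<forall>i. \<omega> i \<notin> A}"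
  show "{\<omega> \<in> space S. \<not> (\<exists>i. \<omega> i \<in> A)} \<subseteq> ?Z" by auto
  show "?Z \<in> sets S" using A by measurable
  have "emeasure S ?Z \<le> ennreal ((1 - measure M A) ^ k)" for k
    unfolding emeasure_no_hit[OF A, symmetric] using A by (intro emeasure_mono) auto
  then have "measure S ?Z \<le> (1 - measure M A) ^ k" for k
    by (simp add: P.emeasure_eq_measure)
  moreover have "(\<lambda>k. (1 - measure M A) ^ k) \<longlonglongrightarrow> 0"
    using p by (intro LIMSEQ_power_zero) auto
  ultimately have "measure S ?Z \<le> 0"
    by (intro LIMSEQ_le_const[of _ 0]) auto
  then show "emeasure S ?Z = 0"
    by (simp add: P.emeasure_eq_measure measure_le_0_iff)
qed

text \<open>Condition on the first entry: either it lies in \<open>A\<close> and contributes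
  \<open>f\<close>, or the search restarts on the tail, which has the same law as the whole
  sequence. The expectation \<open>h\<close> thus solves \<open>h = i + h * (1 - m)\<close>, where
  \<open>i\<close> is the integral of \<open>f\<close> over \<open>A\<close> and \<open>m\<close>
  the measure of \<open>A\<close>.\<close>

lemma integral_at_first_hit:
  fixes f :: "'a \<Rightarrow> real"
  assumes A [measurable]: "A \<in> sets M" and p: "measure M A > 0"
    and f [measurable]: "f \<in> borel_measurable M" and bnd: "\<And>x. x \<in> space M \<Longrightarrow> \<bar>f x\<bar> \<le> 1"
  shows "(\<integral>\<omega>. f (\<omega> (first_hit A \<omega>)) \<partial>S) = (\<integral>x. f x * indicator A x \<partial>M) / measure M A"
proof -
  \<comment> \<open>The default 0 on sequences without a hit makes the recursion \<open>step\<close>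
    hold for every sequence, not only almost every one.\<close>
  define H where "H \<omega> = (if \<exists>i. \<omega> i \<in> A then f (\<omega> (first_hit A \<omega>)) else 0)" for \<omega>
  have H_meas [measurable]: "H \<in> borel_measurable S"
    unfolding H_def using measurable_at_first_hit[OF A f] by measurable
  have H_bnd: "\<bar>H \<omega>\<bar> \<le> 1" if "\<omega> \<in> space S" for \<omega>
    using that bnd by (auto simp: H_def space_PiM PiE_iff)
  have H_int: "integrable S H"
    by (rule P.integrable_const_bound[where B=1]) (use H_bnd in auto)
  have f_int: "integrable M f"
    by (rule M.integrable_const_bound[where B=1]) (use bnd in auto)
  have fA: "integrable M (\<lambda>x. f x * indicator A x)"
    using f_int by (intro integrable_real_mult_indicator) auto
  have step: "H (case_nat x \<omega>) = f x * indicator A x + indicator (space M - A) x * H \<omega>"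
    if x: "x \<in> space M" for x \<omega>
  proof (cases "x \<in> A")
    case True
    then have "first_hit A (case_nat x \<omega>) = 0" unfolding first_hit_def by (intro Least_eq_0) simp
    moreover have "\<exists>i. case_nat x \<omega> i \<in> A" using True by (intro exI[of _ 0]) simp
    ultimately show ?thesis using True by (simp add: H_def)
  next
    case False
    have "(\<exists>i. case_nat x \<omega> i \<in> A) \<longleftrightarrow> (\<exists>i. \<omega> i \<in> A)"
      using False by (subst ex_nat_split) simp
    moreover have "first_hit A (case_nat x \<omega>) = Suc (first_hit A \<omega>)" if "\<exists>i. \<omega> i \<in> A"
    proof -
      from that obtain i where "case_nat x \<omega> (Suc i) \<in> A" by auto
      then show ?thesis
        using Least_Suc[of "\<lambda>i. case_nat x \<omega> i \<in> A" "Suc i"] False by (simp add: first_hit_def)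
    qed
    ultimately show ?thesis using False x by (simp add: H_def)
  qed
  have cA: "integrable M (indicator (space M - A) :: 'a \<Rightarrow> real)"
    by (rule M.integrable_const_bound[where B=1]) (auto simp: indicator_def)
  interpret MS: pair_prob_space M S ..
  define F where "F z = f (fst z) * indicator A (fst z) + indicator (space M - A) (fst z) * H (snd z)"
    for z
  have F_meas: "F \<in> borel_measurable (M \<Otimes>\<^sub>M S)"
    unfolding F_def by measurable
  have F_int: "integrable (M \<Otimes>\<^sub>M S) F"
  proof (rule MS.P.integrable_const_bound[where B=2])
    show "AE z in M \<Otimes>\<^sub>M S. norm (F z) \<le> 2"
    proof (rule AE_I2)
      fix z assume "z \<in> space (M \<Otimes>\<^sub>M S)"
      then have "\<bar>f (fst z)\<bar> \<le> 1" "\<bar>H (snd z)\<bar> \<le> 1"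
        using bnd[of "fst z"] H_bnd[of "snd z"] by (auto simp only: space_pair_measure mem_Times_iff)
      then show "norm (F z) \<le> 2"
        by (auto simp: F_def indicator_def)
    qed
  qed (rule F_meas)
  have shift: "(\<lambda>(x, \<omega>). case_nat x \<omega>) \<in> M \<Otimes>\<^sub>M S \<rightarrow>\<^sub>M S"
    by measurable
  \<comment> \<open>Prepending an independent entry to a sequence preserves the law
    \<open>S\<close>.\<close>
  have "(\<integral>\<omega>. H \<omega> \<partial>S) = (\<integral>\<omega>. H \<omega> \<partial>distr (M \<Otimes>\<^sub>M S) S (\<lambda>(x, \<omega>). case_nat x \<omega>))"
    by (simp only: PiM_iter)
  also have "\<dots> = (\<integral>z. H (case z of (x, \<omega>) \<Rightarrow> case_nat x \<omega>) \<partial>(M \<Otimes>\<^sub>M S))"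
    by (rule integral_distr[OF shift H_meas])
  also have "\<dots> = (\<integral>z. F z \<partial>(M \<Otimes>\<^sub>M S))"
  proof (rule Bochner_Integration.integral_cong[OF refl])
    fix z assume "z \<in> space (M \<Otimes>\<^sub>M S)"
    then have "fst z \<in> space M" by (simp only: space_pair_measure mem_Times_iff)
    then show "H (case z of (x, \<omega>) \<Rightarrow> case_nat x \<omega>) = F z"
      using step[of "fst z" "snd z"] by (simp add: F_def split_beta)
  qed
  also have "\<dots> = (\<integral>x. (\<integral>\<omega>. F (x, \<omega>) \<partial>S) \<partial>M)"
    by (rule MS.integral_fst'[OF F_int, symmetric])
  also have "\<dots> = (\<integral>x. f x * indicator A x + (\<integral>\<omega>. H \<omega> \<partial>S) * indicator (space M - A) x \<partial>M)"
    using H_int by (simp add: F_def P.prob_space mult.commute)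
  also have "\<dots> = (\<integral>x. f x * indicator A x \<partial>M) + (\<integral>\<omega>. H \<omega> \<partial>S) * (1 - measure M A)"
    using fA cA A by (subst Bochner_Integration.integral_add) (auto simp: M.prob_compl)
  finally have "(\<integral>\<omega>. H \<omega> \<partial>S)
      = (\<integral>x. f x * indicator A x \<partial>M) + (\<integral>\<omega>. H \<omega> \<partial>S) * (1 - measure M A)" .
  moreover have "h * m = i" if "h = i + h * (1 - m)" for h i m :: real
    using that by argo
  ultimately have "(\<integral>\<omega>. H \<omega> \<partial>S) * measure M A = (\<integral>x. f x * indicator A x \<partial>M)"
    by blast
  then have "(\<integral>\<omega>. H \<omega> \<partial>S) = (\<integral>x. f x * indicator A x \<partial>M) / measure M A"
    using p by (metis less_irrefl nonzero_eq_divide_eq)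
  moreover have "(\<integral>\<omega>. f (\<omega> (first_hit A \<omega>)) \<partial>S) = (\<integral>\<omega>. H \<omega> \<partial>S)"
  proof (rule integral_cong_AE[OF measurable_at_first_hit[OF A f] H_meas])
    show "AE \<omega> in S. f (\<omega> (first_hit A \<omega>)) = H \<omega>"
      using AE_hit[OF A p] by eventually_elim (simp only: H_def if_True)
  qed
  ultimately show ?thesis by simp
qed

end

subsection \<open>Gaussian vectors\<close>

abbreviation "std_gauss \<equiv> density lborel (\<lambda>x. ennreal (std_normal_density x))"

text \<open>Infinitely many coordinates, of which \<open>dot n\<close> reads the first
  \<open>n\<close>, so that a single measure serves every dimension.\<close>

definition gauss_seq :: "(nat \<Rightarrow> real) measure" where
  "gauss_seq = PiM UNIV (\<lambda>_. std_gauss)"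

interpretation gauss: prob_space std_gauss
  using prob_space_normal_density[of 1 0] by simp
interpretation gauss_seq: sequence_space std_gauss ..

lemma prob_space_gauss_seq: "prob_space gauss_seq"
  unfolding gauss_seq_def by (rule gauss_seq.P.prob_space_axioms)

lemma sets_gauss_seq [measurable_cong]: "sets gauss_seq = sets (PiM UNIV (\<lambda>_. borel))"
  unfolding gauss_seq_def by (intro sets_PiM_cong) auto

lemma space_gauss_seq [simp]: "space gauss_seq = UNIV"
  unfolding gauss_seq_def by (simp add: space_PiM)

definition dot :: "nat \<Rightarrow> (nat \<Rightarrow> real) \<Rightarrow> (nat \<Rightarrow> real) \<Rightarrow> real" where
  "dot n a b = (\<Sum>i<n. a i * b i)"

lemma measurable_dot [measurable]: "dot n a \<in> borel_measurable gauss_seq"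
  unfolding dot_def by measurable

lemma measurable_L2_set [measurable]: "(\<lambda>g. L2_set g {..<n}) \<in> borel_measurable gauss_seq"
  unfolding L2_set_def by measurable

lemma dot_self: "dot n a a = (L2_set a {..<n})\<^sup>2"
  by (simp add: dot_def L2_set_def sum_nonneg power2_eq_square)

lemma dot_commute: "dot n a b = dot n b a"
  by (simp add: dot_def mult.commute)

lemma abs_dot_le: "\<bar>dot n a b\<bar> \<le> L2_set a {..<n} * L2_set b {..<n}"
proof -
  have "\<bar>dot n a b\<bar> \<le> (\<Sum>i<n. \<bar>a i\<bar> * \<bar>b i\<bar>)"
    unfolding dot_def abs_mult[symmetric] by (rule sum_abs)
  also have "\<dots> \<le> L2_set a {..<n} * L2_set b {..<n}"
    by (rule L2_set_mult_ineq)
  finally show ?thesis .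
qed

lemma indep_coords:
  assumes "I \<noteq> {}"
  shows "prob_space.indep_vars gauss_seq (\<lambda>_. borel) (\<lambda>i g. a i * g i) I"
proof -
  interpret prob_space gauss_seq by (rule prob_space_gauss_seq)
  have "indep_vars (\<lambda>_. borel) (\<lambda>i g. g i) (UNIV :: nat set)"
  proof (subst indep_vars_iff_distr_eq_PiM')
    have "distr gauss_seq borel (\<lambda>g. g i) = std_gauss" for i :: nat
      using gauss_seq.PiM_component[of i] by (simp add: gauss_seq_def cong: distr_cong)
    then show "distr gauss_seq (Pi\<^sub>M UNIV (\<lambda>i. borel)) (\<lambda>x. \<lambda>i\<in>UNIV. x i) =
      Pi\<^sub>M UNIV (\<lambda>i. distr gauss_seq borel (\<lambda>g. g i))"
      by (simp add: gauss_seq_def[symmetric] distr_id2 sets_gauss_seq restrict_UNIV)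
  qed auto
  then have "indep_vars (\<lambda>_. borel) (\<lambda>i g. g i) I"
    by (rule indep_vars_subset) auto
  then show ?thesis
    using indep_vars_compose2[of "\<lambda>_. borel" "\<lambda>i g. g i" I "\<lambda>i x. a i * x" "\<lambda>_. borel"] by auto
qed

lemma distributed_coord: "distributed gauss_seq lborel (\<lambda>g. g i) (\<lambda>x. ennreal (std_normal_density x))"
  using gauss_seq.PiM_component[of i]
  by (auto simp: distributed_def gauss_seq_def cong: distr_cong)


lemma distributed_dot:
  assumes "L2_set a {..<n} > 0"
  shows "distributed gauss_seq lborel (dot n a) (\<lambda>x. ennreal (normal_density 0 (L2_set a {..<n}) x))"
proof -
  interpret prob_space gauss_seq by (rule prob_space_gauss_seq)
  \<comment> \<open>Coordinates with coefficient 0 are dropped: their terms are constant and have no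
    normal density.\<close>
  let ?I = "{i. i < n \<and> a i \<noteq> 0}"
  have sum_eq: "(\<Sum>i\<in>?I. f i) = (\<Sum>i<n. f i)" if "\<And>i. a i = 0 \<Longrightarrow> f i = 0" for f :: "nat \<Rightarrow> real"
    using that by (intro sum.mono_neutral_left) auto
  have ne: "?I \<noteq> {}"
  proof
    assume "?I = {}"
    then have "L2_set a {..<n} = 0" by (auto simp: L2_set_def)
    with assms show False by simp
  qed
  have "distributed gauss_seq lborel (\<lambda>g. 0 + a i * g i)
      (\<lambda>x. ennreal (normal_density (0 + a i * 0) (\<bar>a i\<bar> * 1) x))" if "a i \<noteq> 0" for i
    using that by (intro normal_density_affine distributed_coord) auto
  then have "distributed gauss_seq lborel (\<lambda>g. \<Sum>i\<in>?I. a i * g i)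
      (normal_density (\<Sum>i\<in>?I. 0) (sqrt (\<Sum>i\<in>?I. \<bar>a i\<bar>\<^sup>2)))"
    using ne by (intro sum_indep_normal indep_coords) auto
  moreover have "(\<lambda>g. \<Sum>i\<in>?I. a i * g i) = dot n a"
    by (auto simp: fun_eq_iff dot_def intro!: sum_eq)
  moreover have "sqrt (\<Sum>i\<in>?I. \<bar>a i\<bar>\<^sup>2) = L2_set a {..<n}"
    by (simp add: L2_set_def sum_eq)
  ultimately show ?thesis by simp
qed

text \<open>The first absolute moment of a centred normal law whose standard deviation is the norm
  of \<open>a\<close>; if the norm is 0, the inner product vanishes identically.\<close>

lemma has_integral_abs_dot:
  "has_bochner_integral gauss_seq (\<lambda>g. \<bar>dot n a g\<bar>) (sqrt (2 / pi) * L2_set a {..<n})"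
proof (cases "L2_set a {..<n} > 0")
  case True
  have "has_bochner_integral lborel (\<lambda>x. normal_density 0 (L2_set a {..<n}) x * \<bar>x\<bar>)
      (sqrt (2 / pi) * L2_set a {..<n})"
    using normal_moment_abs_odd[OF True, of 0 0] by (simp add: mult.commute)
  then show ?thesis
    using distributed_integrable[OF distributed_dot[OF True], of abs]
      distributed_integral[OF distributed_dot[OF True], of abs]
    by (auto simp: has_bochner_integral_iff)
next
  case False
  then have "L2_set a {..<n} = 0" using L2_set_nonneg[of a "{..<n}"] by linarith
  moreover from this have "dot n a g = 0" for g using abs_dot_le[of n a g] by simp
  ultimately show ?thesis by (simp add: has_bochner_integral_zero)
qed

lemma integrable_dot: "integrable gauss_seq (dot n a)"
  using has_integral_abs_dot[of n a] by (auto simp: has_bochner_integral_iff integrable_abs_iff)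

text \<open>Unlike \<open>sgn\<close>, it takes the value 1 at 0, so that it is always a legal
  output.\<close>

definition sign :: "real \<Rightarrow> real" where
  "sign x = (if x \<ge> 0 then 1 else - 1)"

lemma sign_simps [simp]: "sign x * x = \<bar>x\<bar>" "x * sign x = \<bar>x\<bar>" "\<bar>sign x\<bar> = 1"
  and sign_cases: "sign x \<in> {1, -1}"
  by (auto simp: sign_def)

lemma measurable_sign [measurable]: "sign \<in> borel_measurable borel"
  unfolding sign_def by measurable

lemma integrable_dot_sign: "integrable gauss_seq (\<lambda>g. dot n a g * sign (dot n b g))"
  by (rule Bochner_Integration.integrable_bound[OF integrable_dot[of n a]]) (auto simp: abs_mult)

text \<open>The function \<open>b \<mapsto> E \<bar>\<langle>b, g\<rangle>\<bar>\<close> is a multiple of the Euclidean norm, and \<open>E (g sign \<langle>b, g\<rangle>)\<close> is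
  a subgradient of it; at a unit vector the only subgradient of the norm is the vector itself.\<close>

lemma integral_dot_sign:
  assumes b: "L2_set b {..<n} = 1"
  shows "(\<integral>g. dot n a g * sign (dot n b g) \<partial>gauss_seq) = sqrt (2 / pi) * dot n a b"
proof -
  define c where "c = (\<integral>g. dot n a g * sign (dot n b g) \<partial>gauss_seq)"
  define \<kappa> where "\<kappa> = sqrt (2 / pi)"
  have "\<kappa> > 0" by (simp add: \<kappa>_def)
  define \<delta> where "\<delta> = c - \<kappa> * dot n a b"
  define K where "K = \<kappa> * dot n a a / 2"
  have "K \<ge> 0" using \<open>\<kappa> > 0\<close> by (simp add: K_def dot_self)
  \<comment> \<open>A linear function of \<open>t\<close>, with \<open>t\<close> of either sign,
    lies below a multiple of \<open>t^2\<close>; this forces its slope \<open>\<delta>\<close> to be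
    0.\<close>
  have key: "t * \<delta> \<le> K * t\<^sup>2" for t
  proof -
    let ?v = "\<lambda>i. b i + t * a i"
    have v: "dot n ?v g = dot n b g + t * dot n a g" for g
      by (simp add: dot_def sum.distrib algebra_simps sum_distrib_left)
    have "\<kappa> + t * c = (\<integral>g. \<bar>dot n b g\<bar> + t * (dot n a g * sign (dot n b g)) \<partial>gauss_seq)"
      using has_integral_abs_dot[of n b] integrable_dot_sign[of n a b]
      by (simp add: c_def \<kappa>_def b has_bochner_integral_iff)
    also have "\<dots> \<le> (\<integral>g. \<bar>dot n ?v g\<bar> \<partial>gauss_seq)"
    proof (rule integral_mono)
      show "integrable gauss_seq (\<lambda>g. \<bar>dot n b g\<bar> + t * (dot n a g * sign (dot n b g)))"
        using integrable_dot[of n b] integrable_dot_sign[of n a b] by simp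
      show "integrable gauss_seq (\<lambda>g. \<bar>dot n ?v g\<bar>)"
        using integrable_dot[of n ?v] by simp
      \<comment> \<open>The subgradient inequality of the absolute value:
        \<open>sign x * (x + y) <= abs (x + y)\<close>.\<close>
      show "\<bar>dot n b g\<bar> + t * (dot n a g * sign (dot n b g)) \<le> \<bar>dot n ?v g\<bar>" for g
        unfolding v by (auto simp: sign_def)
    qed
    also have "\<dots> = \<kappa> * L2_set ?v {..<n}"
      using has_integral_abs_dot[of n ?v] by (simp add: \<kappa>_def has_bochner_integral_iff)
    \<comment> \<open>Bounding a norm \<open>x\<close> by \<open>(1 + x^2) / 2\<close> removes the
      square root. The bound is tight to first order at \<open>x = 1\<close>, so only a term in
      \<open>t^2\<close> is lost.\<close>
    also have "\<dots> \<le> \<kappa> * ((1 + (L2_set ?v {..<n})\<^sup>2) / 2)"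
      using \<open>\<kappa> > 0\<close> sum_squares_bound[of 1 "L2_set ?v {..<n}"] by (intro mult_left_mono) auto
    also have "(L2_set ?v {..<n})\<^sup>2 = 1 + 2 * t * dot n a b + t\<^sup>2 * dot n a a"
    proof -
      have "(L2_set ?v {..<n})\<^sup>2 = dot n b ?v + t * dot n a ?v"
        unfolding dot_self[symmetric] v ..
      also have "\<dots> = dot n ?v b + t * dot n ?v a"
        by (simp only: dot_commute)
      also have "\<dots> = dot n b b + 2 * t * dot n a b + t\<^sup>2 * dot n a a"
        unfolding v using dot_commute[of n a b] by (simp add: algebra_simps power2_eq_square)
      finally show ?thesis by (simp add: dot_self b)
    qed
    finally show ?thesis
      by (simp add: \<delta>_def K_def algebra_simps add_divide_distrib)
  qed
  \<comment> \<open>With this \<open>t\<close>, \<open>key\<close> reads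
    \<open>t^2 * (K + 1) <= K * t^2\<close>. Adding 1 to \<open>K\<close> avoids a division by
    0.\<close>
  define t where "t = \<delta> / (K + 1)"
  have \<delta>_eq: "\<delta> = t * (K + 1)" using \<open>K \<ge> 0\<close> by (simp add: t_def)
  have "t\<^sup>2 \<le> 0" using key[of t] by (simp add: \<delta>_eq algebra_simps power2_eq_square)
  then have "\<delta> = 0" by (simp add: \<delta>_eq)
  then show ?thesis by (simp add: \<delta>_def c_def \<kappa>_def)
qed

text \<open>The norm is at most \<open>(x / s + s) / 2\<close>, where \<open>x\<close> is its square
  and \<open>s > 0\<close>, so the second moment \<open>n\<close> controls its mean. Taking
  \<open>s = 1\<close> gives integrability, and \<open>s = sqrt n\<close> gives the bound.\<close>

lemma expectation_L2_set:
  shows integrable_L2_set: "integrable gauss_seq (\<lambda>g. L2_set g {..<n})"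
    and integral_L2_set_le: "(\<integral>g. L2_set g {..<n} \<partial>gauss_seq) \<le> sqrt (real n)"
proof -
  interpret prob_space gauss_seq by (rule prob_space_gauss_seq)
  have "has_bochner_integral lborel (\<lambda>x. std_normal_density x * x\<^sup>2) 1"
    using std_normal_moment_even[of 1] by simp
  then have sq: "has_bochner_integral gauss_seq (\<lambda>g. (g i)\<^sup>2) 1" for i
    using distributed_integrable[OF distributed_coord[of i], of "\<lambda>x. x\<^sup>2"]
      distributed_integral[OF distributed_coord[of i], of "\<lambda>x. x\<^sup>2"]
    by (auto simp: has_bochner_integral_iff)
  have sum_sq: "has_bochner_integral gauss_seq (\<lambda>g. \<Sum>i<n. (g i)\<^sup>2) (\<Sum>i<n. 1)"
    by (rule has_bochner_integral_sum) (rule sq)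
  have L2_sq: "(L2_set g {..<n})\<^sup>2 = (\<Sum>i<n. (g i)\<^sup>2)" for g :: "nat \<Rightarrow> real"
    by (simp add: L2_set_def sum_nonneg)
  have le: "L2_set g {..<n} \<le> ((\<Sum>i<n. (g i)\<^sup>2) / s + s) / 2" if "s > 0" for s and g :: "nat \<Rightarrow> real"
  proof -
    have "L2_set g {..<n} * (2 * s) \<le> (\<Sum>i<n. (g i)\<^sup>2) + s\<^sup>2"
      using sum_squares_bound[of "L2_set g {..<n}" s] by (simp add: L2_sq mult.assoc mult.left_commute)
    then have "L2_set g {..<n} \<le> ((\<Sum>i<n. (g i)\<^sup>2) + s\<^sup>2) / (2 * s)"
      using that by (simp add: pos_le_divide_eq)
    also have "\<dots> = ((\<Sum>i<n. (g i)\<^sup>2) / s + s) / 2"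
      using that by (simp add: add_divide_distrib power2_eq_square)
    finally show ?thesis .
  qed
  have int: "integrable gauss_seq (\<lambda>g. ((\<Sum>i<n. (g i)\<^sup>2) / s + s) / 2)" for s
    using sum_sq by (auto simp: has_bochner_integral_iff)
  show L2_int: "integrable gauss_seq (\<lambda>g. L2_set g {..<n})"
    by (rule Bochner_Integration.integrable_bound[OF int[of 1]])
       (use le[of 1] in \<open>auto simp: L2_set_nonneg intro!: AE_I2 order_trans[OF _ abs_ge_self]\<close>)
  show "(\<integral>g. L2_set g {..<n} \<partial>gauss_seq) \<le> sqrt (real n)"
  proof (cases "n = 0")
    case False
    let ?s = "sqrt (real n)"
    have "(\<integral>g. L2_set g {..<n} \<partial>gauss_seq) \<le> (\<integral>g. ((\<Sum>i<n. (g i)\<^sup>2) / ?s + ?s) / 2 \<partial>gauss_seq)"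
      using False by (intro integral_mono L2_int int le) auto
    also have "\<dots> = (real n / ?s + ?s) / 2"
      using sum_sq prob_space by (simp add: has_bochner_integral_iff)
    also have "\<dots> = ?s" by (simp add: real_div_sqrt)
    finally show ?thesis .
  qed (simp add: L2_set_def)
qed

text \<open>The norm dominates the absolute value of a single coordinate. This makes the normalising
  constant \<open>mean_norm n\<close> positive.\<close>

lemma integral_L2_set_ge:
  assumes "n > 0"
  shows "sqrt (2 / pi) \<le> (\<integral>g. L2_set g {..<n} \<partial>gauss_seq)"
proof -
  define e where "e = (\<lambda>i::nat. if i = 0 then 1 else 0 :: real)"
  have e: "L2_set e {..<n} = 1"
    using assms by (simp add: L2_set_def e_def if_distrib[of "\<lambda>x. x\<^sup>2"] sum.delta cong: if_cong)
  have "(\<integral>g. \<bar>dot n e g\<bar> \<partial>gauss_seq) \<le> (\<integral>g. L2_set g {..<n} \<partial>gauss_seq)"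
    using abs_dot_le[of n e] integrable_dot[of n e]
    by (intro integral_mono integrable_L2_set) (auto simp: e)
  then show ?thesis
    using has_integral_abs_dot[of n e] by (simp add: has_bochner_integral_iff e)
qed


section \<open>Norm-weighted Gaussian vectors and the acceptance test\<close>

definition unit_interval :: "real measure" where
  "unit_interval = uniform_measure lborel {0..1}"

definition mean_norm :: "nat \<Rightarrow> real" where
  "mean_norm n = (\<integral>g. L2_set g {..<n} \<partial>gauss_seq)"

definition tilted_gauss :: "nat \<Rightarrow> (nat \<Rightarrow> real) measure" where
  "tilted_gauss n = density gauss_seq (\<lambda>g. ennreal (L2_set g {..<n} / mean_norm n))"

definition proposal :: "nat \<Rightarrow> ((nat \<Rightarrow> real) \<times> real) measure" where
  "proposal n = tilted_gauss n \<Otimes>\<^sub>M unit_interval"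

text \<open>The second component is a uniform coin; for a unit vector \<open>a\<close>, a nonzero
  vector \<open>g\<close> is accepted with probability \<open>abs (dot n a g)\<close> divided by its
  norm. The product form avoids dividing by a norm that may be 0.\<close>

definition accepted :: "nat \<Rightarrow> (nat \<Rightarrow> real) \<Rightarrow> ((nat \<Rightarrow> real) \<times> real) set" where
  "accepted n a = {z. snd z * L2_set (fst z) {..<n} < \<bar>dot n a (fst z)\<bar>}"

lemma sets_unit_interval [measurable_cong]: "sets unit_interval = sets borel"
  by (simp add: unit_interval_def)

lemma sets_tilted_gauss [measurable_cong]: "sets (tilted_gauss n) = sets gauss_seq"
  by (simp add: tilted_gauss_def)

lemma space_proposal [simp]: "space (proposal n) = UNIV"
  by (simp add: proposal_def space_pair_measure tilted_gauss_def unit_interval_def)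

lemma prob_space_unit_interval: "prob_space unit_interval"
  unfolding unit_interval_def by (rule prob_space_uniform_measure) auto

lemma mean_norm_pos: "n > 0 \<Longrightarrow> mean_norm n > 0"
  using integral_L2_set_ge[of n] less_le_trans[of 0 "sqrt (2 / pi)" "mean_norm n"]
  by (simp add: mean_norm_def)

lemma prob_space_tilted_gauss:
  assumes "n > 0"
  shows "prob_space (tilted_gauss n)"
proof
  have "emeasure (tilted_gauss n) (space (tilted_gauss n))
      = (\<integral>\<^sup>+g. ennreal (L2_set g {..<n} / mean_norm n) \<partial>gauss_seq)"
    unfolding tilted_gauss_def by (subst emeasure_density) (auto simp del: space_gauss_seq)
  also have "\<dots> = ennreal (\<integral>g. L2_set g {..<n} / mean_norm n \<partial>gauss_seq)"
    using mean_norm_pos[OF assms] integrable_L2_set[of n]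
    by (intro nn_integral_eq_integral) (auto simp: L2_set_nonneg)
  also have "(\<integral>g. L2_set g {..<n} / mean_norm n \<partial>gauss_seq) = 1"
    using mean_norm_pos[OF assms] by (simp add: mean_norm_def)
  finally show "emeasure (tilted_gauss n) (space (tilted_gauss n)) = 1" by simp
qed

lemma prob_space_proposal:
  assumes "n > 0"
  shows "prob_space (proposal n)"
proof -
  interpret pair_prob_space "tilted_gauss n" unit_interval
    unfolding pair_prob_space_def pair_sigma_finite_def
    using prob_space_tilted_gauss[OF assms] prob_space_unit_interval
    by (auto intro: prob_space_imp_sigma_finite)
  show ?thesis unfolding proposal_def by (rule P.prob_space_axioms)
qed

lemma measurable_accepted [measurable]: "accepted n a \<in> sets (proposal n)"
proof -
  have [measurable_cong]: "sets (proposal n) = sets (gauss_seq \<Otimes>\<^sub>M borel)"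
    unfolding proposal_def by (intro sets_pair_measure_cong sets_tilted_gauss sets_unit_interval)
  have "{z \<in> space (proposal n). snd z * L2_set (fst z) {..<n} < \<bar>dot n a (fst z)\<bar>} \<in> sets (proposal n)"
    by measurable
  then show ?thesis by (simp add: accepted_def)
qed

text \<open>Since \<open>s <= r\<close>, the threshold \<open>s / r\<close> stays inside the unit
  interval. Multiplying by \<open>r\<close> covers the case \<open>r = 0\<close> and gives the form
  in which the norm in the tilted density cancels.\<close>

lemma integral_acceptance_prob:
  fixes r s :: real
  assumes "0 \<le> s" "s \<le> r"
  shows "r * (\<integral>u. (if u * r < s then 1 else 0) \<partial>unit_interval) = s"
proof (cases "r = 0")
  case False
  with assms have r: "r > 0" by simp
  have "(\<integral>u. (if u * r < s then 1 else 0) \<partial>unit_interval) = (\<integral>u. indicator {u. u * r < s} u \<partial>unit_interval)"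
    by (intro Bochner_Integration.integral_cong) (auto simp: indicator_def)
  also have "\<dots> = measure unit_interval {u. u * r < s}"
    by (simp add: unit_interval_def)
  also have "\<dots> = measure lborel ({0..1} \<inter> {u. u * r < s}) / measure lborel {0..1::real}"
    unfolding unit_interval_def by (intro measure_uniform_measure) auto
  also have "{0..1} \<inter> {u. u * r < s} = {0..<s / r}"
  proof -
    have "u \<le> 1" if "u * r < s" for u
      using less_le_trans[OF that assms(2)] r mult_less_cancel_right_pos[of r u 1] by simp
    then show ?thesis using r by (auto simp: pos_less_divide_eq)
  qed
  also have "measure lborel {0..<s / r} / measure lborel {0..1::real} = s / r"
    using assms r by simp
  finally show ?thesis using r by simp
qed (use assms in auto)

text \<open>Integrate over the coin first. The norm in the density of \<open>tilted_gauss\<close>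
  cancels the denominator of the acceptance probability, which leaves the weight
  \<open>abs (dot n a g)\<close> against the Gaussian law.\<close>

lemma integral_accepted:
  assumes n: "n > 0" and a: "L2_set a {..<n} = 1"
    and F [measurable]: "F \<in> borel_measurable gauss_seq" and F_bnd: "\<And>g. \<bar>F g\<bar> \<le> 1"
  shows "(\<integral>z. F (fst z) * indicator (accepted n a) z \<partial>proposal n)
    = (\<integral>g. F g * \<bar>dot n a g\<bar> \<partial>gauss_seq) / mean_norm n"
proof -
  interpret pair_prob_space "tilted_gauss n" unit_interval
    unfolding pair_prob_space_def pair_sigma_finite_def
    using prob_space_tilted_gauss[OF n] prob_space_unit_interval
    by (auto intro: prob_space_imp_sigma_finite)
  define h where "h g = (\<integral>u. (if u * L2_set g {..<n} < \<bar>dot n a g\<bar> then 1 else 0 :: real) \<partial>unit_interval)"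
    for g
  have acc: "accepted n a \<in> sets (tilted_gauss n \<Otimes>\<^sub>M unit_interval)"
    using measurable_accepted[of n a] by (simp add: proposal_def)
  have int: "integrable (tilted_gauss n \<Otimes>\<^sub>M unit_interval) (\<lambda>z. F (fst z) * indicator (accepted n a) z)"
    using F_bnd acc by (intro P.integrable_const_bound[where B=1]) (auto simp: indicator_def)
  have h_meas [measurable]: "h \<in> borel_measurable gauss_seq"
    unfolding h_def by measurable
  have "(\<integral>z. F (fst z) * indicator (accepted n a) z \<partial>proposal n)
      = (\<integral>g. (\<integral>u. F g * indicator (accepted n a) (g, u) \<partial>unit_interval) \<partial>tilted_gauss n)"
    unfolding proposal_def using integral_fst'[OF int] by simp
  also have "\<dots> = (\<integral>g. F g * h g \<partial>tilted_gauss n)"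
    by (simp add: h_def accepted_def indicator_def of_bool_def cong: if_cong)
  also have "\<dots> = (\<integral>g. L2_set g {..<n} / mean_norm n * (F g * h g) \<partial>gauss_seq)"
    unfolding tilted_gauss_def using mean_norm_pos[OF n]
    by (subst integral_density) (auto simp: L2_set_nonneg)
  also have "\<dots> = (\<integral>g. F g * \<bar>dot n a g\<bar> / mean_norm n \<partial>gauss_seq)"
  proof (rule Bochner_Integration.integral_cong[OF refl])
    fix g
    have "L2_set g {..<n} * h g = \<bar>dot n a g\<bar>"
      unfolding h_def using abs_dot_le[of n a g] by (intro integral_acceptance_prob) (auto simp: a)
    then show "L2_set g {..<n} / mean_norm n * (F g * h g) = F g * \<bar>dot n a g\<bar> / mean_norm n"
      by (metis mult.commute mult.left_commute times_divide_eq_left)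
  qed
  finally show ?thesis by simp
qed

text \<open>The case \<open>F = 1\<close>. The value is the same for all unit vectors
  \<open>a\<close>, as \<open>rejection_simulation\<close> requires of its \<open>p\<close>.\<close>

lemma measure_accepted:
  assumes n: "n > 0" and a: "L2_set a {..<n} = 1"
  shows "measure (proposal n) (accepted n a) = sqrt (2 / pi) / mean_norm n"
  using integral_accepted[OF n a, of "\<lambda>_. 1"] has_integral_abs_dot[of n a]
  by (simp add: has_bochner_integral_iff a)

text \<open>The weight left by acceptance and Alice's sign multiply to \<open>dot n a g\<close>,
  which reduces the claim to \<open>integral_dot_sign\<close>.\<close>

lemma integral_sign_accepted:
  assumes n: "n > 0" and a: "L2_set a {..<n} = 1" and b: "L2_set b {..<n} = 1"
  shows "(\<integral>z. sign (dot n a (fst z)) * sign (dot n b (fst z)) * indicator (accepted n a) z \<partial>proposal n)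
    = sqrt (2 / pi) * dot n a b / mean_norm n"
proof -
  have "sign (dot n a g) * sign (dot n b g) * \<bar>dot n a g\<bar> = dot n a g * sign (dot n b g)" for g
    by (simp add: sign_def)
  then have "(\<lambda>g. sign (dot n a g) * sign (dot n b g) * \<bar>dot n a g\<bar>) = (\<lambda>g. dot n a g * sign (dot n b g))"
    by (rule ext)
  then show ?thesis
    using integral_accepted[OF n a, of "\<lambda>g. sign (dot n a g) * sign (dot n b g)"]
    by (simp only: integral_dot_sign[OF b]) (simp add: abs_mult)
qed

subsection \<open>The protocol\<close>

text \<open>The Golomb-Rice code with divisor \<open>2 ^ L\<close>: the remainder with its least
  significant bit first, then the quotient as a run of \<open>True\<close> closed by one
  \<open>False\<close>.\<close>

definition code_bit :: "nat \<Rightarrow> nat \<Rightarrow> nat \<Rightarrow> bool" where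
  "code_bit L k i = (if i < L then bit k i else i - L < k div 2 ^ L)"

definition code_length :: "nat \<Rightarrow> nat \<Rightarrow> nat" where
  "code_length L k = L + 1 + k div 2 ^ L"

text \<open>A \<open>False\<close> among the first \<open>L\<close> bits belongs to the remainder
  and must not end the message. The length test also ensures that \<open>last\<close> is applied to
  a nonempty list.\<close>

definition code_turn :: "nat \<Rightarrow> bool list \<Rightarrow> party option" where
  "code_turn L h = (if length h > L \<and> \<not> last h then None else Some Alice)"

text \<open>The subtracted 1 accounts for the closing \<open>False\<close>.\<close>

definition decode :: "nat \<Rightarrow> bool list \<Rightarrow> nat" where
  "decode L h = horner_sum of_bool 2 (take L h) + (length h - L - 1) * 2 ^ L"

text \<open>For \<open>n > L\<close> the last bit is \<open>True\<close> exactly while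
  \<open>n - 1 - L < k div 2 ^ L\<close>, which first fails at
  \<open>n = code_length L k\<close>.\<close>

lemma code_turn_prefix:
  assumes "n \<le> code_length L k"
  shows "code_turn L (map (code_bit L k) [0..<n]) = (if n = code_length L k then None else Some Alice)"
proof (cases "n > L")
  case True
  then have "last (map (code_bit L k) [0..<n]) = code_bit L k (n - 1)"
    by (simp add: last_map)
  then show ?thesis
    using True assms by (auto simp: code_turn_def code_bit_def code_length_def)
next
  case False
  then show ?thesis by (auto simp: code_turn_def code_length_def)
qed

lemma decode_code: "decode L (map (code_bit L k) [0..<code_length L k]) = k"
proof -
  have "take L (map (code_bit L k) [0..<code_length L k]) = map (bit k) [0..<L]"
    by (auto simp: take_map code_length_def code_bit_def)
  then have "decode L (map (code_bit L k) [0..<code_length L k]) = take_bit L k + (k div 2 ^ L) * 2 ^ L"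
    by (simp add: decode_def horner_sum_bit_eq_take_bit code_length_def)
  then show ?thesis by (simp only: take_bit_eq_mod mod_mult_div_eq mod_div_mult_eq)
qed

text \<open>Here \<open>\<psi>\<close> maps the shared randomness to the sequence of candidates; it
  is not the quantum state. Communication goes one way, from Alice to Bob.\<close>

definition rejection_protocol ::
  "nat \<Rightarrow> 'r measure \<Rightarrow> ('r \<Rightarrow> nat \<Rightarrow> 'a) \<Rightarrow> ('x \<Rightarrow> 'a set) \<Rightarrow> ('x \<Rightarrow> 'a \<Rightarrow> real) \<Rightarrow> ('y \<Rightarrow> 'a \<Rightarrow> real)
    \<Rightarrow> ('x, 'y, 'r) lhv_protocol" where
  "rejection_protocol L R \<psi> acc f g =
    \<lparr>randomness = R, turn = code_turn L,
     alice_bit = (\<lambda>x r h. code_bit L (first_hit (acc x) (\<psi> r)) (length h)),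
     bob_bit = (\<lambda>y r h. False),
     alice_out = (\<lambda>x r h. f x (\<psi> r (decode L h))),
     bob_out = (\<lambda>y r h. g y (\<psi> r (decode L h)))\<rparr>"

text \<open>Communication ends for every \<open>r\<close>, not only almost surely: even without an
  accepted candidate, \<open>first_hit\<close> denotes some natural number, and its code word is
  finite.\<close>

lemma rejection_protocol_run:
  fixes acc :: "'x \<Rightarrow> 'a set" and L R \<psi> f g
  defines "P \<equiv> rejection_protocol L R \<psi> acc f g" and "k \<equiv> \<lambda>x r. first_hit (acc x) (\<psi> r)"
  shows "ends P x y r" "num_bits P x y r = code_length L (k x r)"
    and "alice_output P x y r = f x (\<psi> r (k x r))" "bob_output P x y r = g y (\<psi> r (k x r))"
proof -
  have sel: "turn P = code_turn L" "alice_bit P x r h = code_bit L (k x r) (length h)" for h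
    by (auto simp: P_def k_def rejection_protocol_def)
  have bits: "bits_after P x y r n = map (code_bit L (k x r)) [0..<n]" if "n \<le> code_length L (k x r)" for n
    using that
  proof (induction n)
    case (Suc n)
    then show ?case using code_turn_prefix[of n L "k x r"] by (simp add: sel Let_def)
  qed simp
  have stop: "turn P (bits_after P x y r n) = (if n = code_length L (k x r) then None else Some Alice)"
    if "n \<le> code_length L (k x r)" for n
    using that by (simp add: bits sel code_turn_prefix)
  then show "ends P x y r" unfolding ends_def by (intro exI[of _ "code_length L (k x r)"]) simp
  show nb: "num_bits P x y r = code_length L (k x r)"
    unfolding num_bits_def
  proof (rule Least_equality)
    fix n assume "turn P (bits_after P x y r n) = None"
    then show "code_length L (k x r) \<le> n" using stop[of n] by (cases "n < code_length L (k x r)") auto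
  qed (simp add: stop)
  show "alice_output P x y r = f x (\<psi> r (k x r))" "bob_output P x y r = g y (\<psi> r (k x r))"
    unfolding alice_output_def bob_output_def nb
    by (simp_all add: bits) (simp_all add: P_def rejection_protocol_def decode_code)
qed

lemma expected_code_length_le:
  assumes K: "K \<in> M \<rightarrow>\<^sub>M count_space UNIV" and M: "prob_space M" and "e \<ge> 0"
    and le: "(\<integral>\<^sup>+\<omega>. of_nat (K \<omega>) \<partial>M) \<le> ennreal e"
  shows "(\<integral>\<^sup>+\<omega>. of_nat (code_length L (K \<omega>)) \<partial>M) \<le> ennreal (real L + 1 + e / 2 ^ L)"
proof -
  interpret prob_space M by (rule M)
  have K' [measurable]: "(\<lambda>\<omega>. of_nat (K \<omega>) :: ennreal) \<in> borel_measurable M"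
    by (rule measurable_compose[OF K]) simp
  have "(\<integral>\<^sup>+\<omega>. of_nat (code_length L (K \<omega>)) \<partial>M)
      \<le> (\<integral>\<^sup>+\<omega>. ennreal (real L + 1) + ennreal (1 / 2 ^ L) * of_nat (K \<omega>) \<partial>M)"
  proof (rule nn_integral_mono)
    fix \<omega>
    have "real (code_length L (K \<omega>)) \<le> (real L + 1) + 1 / 2 ^ L * real (K \<omega>)"
      using of_nat_div_le_of_nat[where 'a=real, of "K \<omega>" "2 ^ L"] by (simp add: code_length_def)
    then show "of_nat (code_length L (K \<omega>)) \<le> ennreal (real L + 1) + ennreal (1 / 2 ^ L) * of_nat (K \<omega>)"
      by (simp add: ennreal_of_nat_eq_real_of_nat ennreal_mult[symmetric] ennreal_plus[symmetric]
          del: ennreal_plus of_nat_add)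
  qed
  also have "\<dots> = ennreal (real L + 1) + ennreal (1 / 2 ^ L) * (\<integral>\<^sup>+\<omega>. of_nat (K \<omega>) \<partial>M)"
    by (simp add: nn_integral_add nn_integral_cmult emeasure_space_1)
  also have "\<dots> \<le> ennreal (real L + 1) + ennreal (1 / 2 ^ L) * ennreal e"
    by (intro add_left_mono mult_left_mono le) auto
  also have "\<dots> = ennreal (real L + 1 + e / 2 ^ L)"
    using \<open>e \<ge> 0\<close> by (simp add: ennreal_mult[symmetric] ennreal_plus[symmetric] del: ennreal_plus)
  finally show ?thesis .
qed

text \<open>The shared randomness is to be one real sequence. The pairing function cuts it into
  rows, one for each candidate: entry 0 is the coin and the later entries are the vector.\<close>

definition unpack :: "(nat \<Rightarrow> real) \<Rightarrow> nat \<Rightarrow> (nat \<Rightarrow> real) \<times> real" where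
  "unpack r k = (\<lambda>i. r (prod_encode (k, Suc i)), r (prod_encode (k, 0)))"

definition pack :: "(nat \<Rightarrow> (nat \<Rightarrow> real) \<times> real) \<Rightarrow> nat \<Rightarrow> real" where
  "pack \<omega> m = (case prod_decode m of (k, 0) \<Rightarrow> snd (\<omega> k) | (k, Suc i) \<Rightarrow> fst (\<omega> k) i)"

lemma unpack_pack: "unpack (pack \<omega>) = \<omega>"
  by (rule ext) (simp add: unpack_def pack_def)

lemma measurable_unpack:
  "unpack \<in> PiM UNIV (\<lambda>_. borel) \<rightarrow>\<^sub>M PiM UNIV (\<lambda>_. PiM UNIV (\<lambda>_. borel) \<Otimes>\<^sub>M borel)"
proof (rule measurable_PiM_single')
  show "(\<lambda>r. unpack r k) \<in> PiM UNIV (\<lambda>_. borel) \<rightarrow>\<^sub>M PiM UNIV (\<lambda>_. borel) \<Otimes>\<^sub>M borel" for k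
    unfolding unpack_def by (intro measurable_Pair measurable_PiM_single') (auto simp: space_PiM)
qed (auto simp: space_PiM space_pair_measure)

lemma measurable_pack:
  "pack \<in> PiM UNIV (\<lambda>_. PiM UNIV (\<lambda>_. borel) \<Otimes>\<^sub>M borel) \<rightarrow>\<^sub>M PiM UNIV (\<lambda>_. borel)"
proof (rule measurable_PiM_single')
  fix m
  obtain k j where m: "prod_decode m = (k, j)" by force
  show "(\<lambda>\<omega>. pack \<omega> m) \<in> PiM UNIV (\<lambda>_. PiM UNIV (\<lambda>_. borel) \<Otimes>\<^sub>M borel) \<rightarrow>\<^sub>M borel"
    unfolding pack_def m by (cases j) simp_all
qed (auto simp: space_PiM)

text \<open>Both parties evaluate their outputs at the first accepted candidate, whose law is
  \<open>M\<close> conditioned on \<open>acc x\<close>. Its index has mean at most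
  \<open>1 / p\<close>, and the unary part of the code divides this by \<open>2 ^ L\<close>.\<close>

lemma rejection_simulation:
  fixes M :: "((nat \<Rightarrow> real) \<times> real) measure"
  assumes M: "prob_space M" and sets_M: "sets M = sets (PiM UNIV (\<lambda>_. borel) \<Otimes>\<^sub>M borel)"
    and acc: "\<And>x. x \<in> X \<Longrightarrow> acc x \<in> sets M" and p: "\<And>x. x \<in> X \<Longrightarrow> measure M (acc x) = p" "p > 0"
    and f: "\<And>x. x \<in> X \<Longrightarrow> f x \<in> borel_measurable M" "\<And>x z. x \<in> X \<Longrightarrow> f x z \<in> {1, -1}"
    and g: "\<And>y. y \<in> Y \<Longrightarrow> g y \<in> borel_measurable M" "\<And>y z. y \<in> Y \<Longrightarrow> g y z \<in> {1, -1}"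
  shows "\<exists>P :: ('x, 'y, nat \<Rightarrow> real) lhv_protocol. valid_lhv_protocol X Y P \<and>
    (\<forall>x\<in>X. \<forall>y\<in>Y. joint_correlation P x y = (\<integral>z. f x z * g y z * indicator (acc x) z \<partial>M) / p \<and>
      expected_bits P x y \<le> ennreal (real L + 1 + (1 / p) / 2 ^ L))"
proof -
  interpret M: prob_space M by (rule M)
  interpret sequence_space M ..
  let ?N = "PiM UNIV (\<lambda>_::nat. borel :: real measure)"
  have sets_S: "sets S = sets (PiM UNIV (\<lambda>_. PiM UNIV (\<lambda>_. borel) \<Otimes>\<^sub>M borel))"
    by (intro sets_PiM_cong refl sets_M)
  have pack: "pack \<in> S \<rightarrow>\<^sub>M ?N"
    using measurable_pack by (simp cong: measurable_cong_sets add: sets_S)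
  have unpack: "unpack \<in> ?N \<rightarrow>\<^sub>M S"
    using measurable_unpack by (simp cong: measurable_cong_sets add: sets_S)
  \<comment> \<open>With the image law under \<open>pack\<close>, \<open>unpack_pack\<close> turns
    every integral of a function of \<open>unpack r\<close> into one over \<open>S\<close>.\<close>
  define R where "R = distr S ?N pack"
  have unpack_R: "unpack \<in> R \<rightarrow>\<^sub>M S"
    using unpack by (simp add: R_def)
  define P where "P = rejection_protocol L R unpack acc f g"
  note run = rejection_protocol_run[of L R unpack acc f g, folded P_def]
  have P_sel: "randomness P = R" "alice_bit P x r h = code_bit L (first_hit (acc x) (unpack r)) (length h)"
    "bob_bit P y r h = False" "alice_out P x r h = f x (unpack r (decode L h))"
    "bob_out P y r h = g y (unpack r (decode L h))" for x y r h
    by (simp_all add: P_def rejection_protocol_def)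
  have hit: "(\<lambda>r. first_hit (acc x) (unpack r)) \<in> R \<rightarrow>\<^sub>M count_space UNIV" if "x \<in> X" for x
    using measurable_compose[OF unpack_R measurable_first_hit[OF acc[OF that]]] .
  have coord: "(\<lambda>r. h (unpack r j)) \<in> borel_measurable R" if "h \<in> borel_measurable M" for h :: "_ \<Rightarrow> real" and j
    by (rule measurable_compose[OF unpack_R], rule measurable_compose[OF _ that])
      (rule measurable_component_singleton, simp)
  have "valid_lhv_protocol X Y P"
    unfolding valid_lhv_protocol_def P_sel
  proof (intro conjI ballI allI)
    show "prob_space R" unfolding R_def by (rule P.prob_space_distr[OF pack])
    show "(\<lambda>r. code_bit L (first_hit (acc x) (unpack r)) (length h)) \<in> R \<rightarrow>\<^sub>M count_space UNIV"
      if "x \<in> X" for x h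
      using measurable_compose[OF hit[OF that], of "\<lambda>k. code_bit L k (length h)"] by simp
  qed (use coord f g run(1) in auto)
  moreover have "joint_correlation P x y = (\<integral>z. f x z * g y z * indicator (acc x) z \<partial>M) / p \<and>
      expected_bits P x y \<le> ennreal (real L + 1 + (1 / p) / 2 ^ L)" if x: "x \<in> X" and y: "y \<in> Y" for x y
  proof
    let ?F = "\<lambda>z. f x z * g y z"
    have F: "?F \<in> borel_measurable M" using f(1)[OF x] g(1)[OF y] by measurable
    have F_bnd: "\<bar>?F z\<bar> \<le> 1" for z using f(2)[OF x, of z] g(2)[OF y, of z] by auto
    have F_hit: "(\<lambda>r. ?F (unpack r (first_hit (acc x) (unpack r)))) \<in> borel_measurable ?N"
      using measurable_compose[OF unpack measurable_at_first_hit[OF acc[OF x] F]] .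
    have "joint_correlation P x y = (\<integral>\<omega>. ?F (\<omega> (first_hit (acc x) \<omega>)) \<partial>S)"
      unfolding joint_correlation_def run P_sel R_def
      by (subst integral_distr[OF pack F_hit]) (simp add: unpack_pack)
    also have "\<dots> = (\<integral>z. f x z * g y z * indicator (acc x) z \<partial>M) / p"
      using integral_at_first_hit[OF acc[OF x] _ F F_bnd] p x by simp
    finally show "joint_correlation P x y = (\<integral>z. f x z * g y z * indicator (acc x) z \<partial>M) / p" .
    have "expected_bits P x y = (\<integral>\<^sup>+r. of_nat (code_length L (first_hit (acc x) (unpack r))) \<partial>R)"
      unfolding expected_bits_def run P_sel ..
    also have "\<dots> = (\<integral>\<^sup>+\<omega>. of_nat (code_length L (first_hit (acc x) \<omega>)) \<partial>S)"
      unfolding R_def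
      by (subst nn_integral_distr[OF pack measurable_compose[OF hit[OF x, unfolded R_def]]])
         (auto simp: unpack_pack)
    also have "\<dots> \<le> ennreal (real L + 1 + (1 / p) / 2 ^ L)"
      using nn_integral_first_hit_le[OF acc[OF x]] p x
      by (intro expected_code_length_le measurable_first_hit acc P.prob_space_axioms) auto
    finally show "expected_bits P x y \<le> ennreal (real L + 1 + (1 / p) / 2 ^ L)" .
  qed
  ultimately show ?thesis by blast
qed

subsection \<open>Correlations as inner products of real vectors\<close>

lemma sum_div_mod:
  fixes f :: "nat \<Rightarrow> nat \<Rightarrow> 'a :: comm_monoid_add"
  shows "(\<Sum>t<k * l. f (t div l) (t mod l)) = (\<Sum>s<k. \<Sum>u<l. f s u)"
proof -
  have "(\<Sum>t<k * l. f (t div l) (t mod l)) = (\<Sum>(s, u)\<in>{..<k} \<times> {..<l}. f s u)"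
  proof (rule sum.reindex_bij_witness[of _ "\<lambda>(s, u). s * l + u" "\<lambda>t. (t div l, t mod l)"])
    fix t assume "t \<in> {..<k * l}"
    then have "l > 0" "t < k * l" by (auto intro: gr0I)
    then show "(t div l, t mod l) \<in> {..<k} \<times> {..<l}"
      by (simp add: less_mult_imp_div_less)
  next
    fix su assume "su \<in> {..<k} \<times> {..<l}"
    then obtain s u where su: "su = (s, u)" "s < k" "u < l" by auto
    have "s * l + u < Suc s * l" using su by simp
    also have "\<dots> \<le> k * l" using su by (intro mult_le_mono1) simp
    finally show "(case su of (s, u) \<Rightarrow> s * l + u) \<in> {..<k * l}" using su by simp
  qed auto
  then show ?thesis by (simp add: sum.cartesian_product)
qed

lemma kronecker_carrier:
  assumes "A \<in> carrier_mat m k" "B \<in> carrier_mat n l"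
  shows "kronecker A B \<in> carrier_mat (m * n) (k * l)"
  using assms by (auto simp: kronecker_def)

lemma kronecker_index:
  assumes "A \<in> carrier_mat m k" "B \<in> carrier_mat n l" "i < m * n" "j < k * l"
  shows "kronecker A B $$ (i, j) = A $$ (i div n, j div l) * B $$ (i mod n, j mod l)"
  using assms by (auto simp: kronecker_def)

lemma div_mod_less:
  assumes "i < m * (n :: nat)"
  shows "i div n < m" "i mod n < n"
proof -
  have "n > 0" using assms by (auto intro: gr0I)
  then show "i div n < m" "i mod n < n"
    using assms by (auto simp: less_mult_imp_div_less)
qed

text \<open>The mixed-product property: writing the summation index as a pair by
  \<open>sum_div_mod\<close> makes the sum factor into the two matrix products.\<close>

lemma kronecker_mult:
  fixes A B C D :: "'a :: comm_semiring_0 mat"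
  assumes A: "A \<in> carrier_mat m k" and B: "B \<in> carrier_mat n l"
    and C: "C \<in> carrier_mat k p" and D: "D \<in> carrier_mat l q"
  shows "kronecker A B * kronecker C D = kronecker (A * C) (B * D)"
proof (rule eq_matI)
  note K = kronecker_carrier[OF A B] kronecker_carrier[OF C D]
  note KM = kronecker_carrier[OF mult_carrier_mat[OF A C] mult_carrier_mat[OF B D]]
  fix i j assume "i < dim_row (kronecker (A * C) (B * D))" "j < dim_col (kronecker (A * C) (B * D))"
  then have ij: "i < m * n" "j < p * q" using KM by auto
  note dm = div_mod_less[OF ij(1)] div_mod_less[OF ij(2)]
  have "(kronecker A B * kronecker C D) $$ (i, j)
      = (\<Sum>t<k * l. kronecker A B $$ (i, t) * kronecker C D $$ (t, j))"
    using K ij by (simp add: scalar_prod_def atLeast0LessThan)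
  also have "\<dots> = (\<Sum>t<k * l. (A $$ (i div n, t div l) * B $$ (i mod n, t mod l)) *
      (C $$ (t div l, j div q) * D $$ (t mod l, j mod q)))"
    using ij by (intro sum.cong refl) (simp add: kronecker_index[OF A B] kronecker_index[OF C D])
  also have "\<dots> = (\<Sum>s<k. \<Sum>u<l. (A $$ (i div n, s) * B $$ (i mod n, u)) *
      (C $$ (s, j div q) * D $$ (u, j mod q)))"
    by (rule sum_div_mod)
  also have "\<dots> = (\<Sum>s<k. A $$ (i div n, s) * C $$ (s, j div q)) * (\<Sum>u<l. B $$ (i mod n, u) * D $$ (u, j mod q))"
    by (simp add: sum_product ac_simps)
  also have "\<dots> = (A * C) $$ (i div n, j div q) * (B * D) $$ (i mod n, j mod q)"
    using A B C D dm by (simp add: scalar_prod_def atLeast0LessThan)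
  also have "\<dots> = kronecker (A * C) (B * D) $$ (i, j)"
    using kronecker_index[OF mult_carrier_mat[OF A C] mult_carrier_mat[OF B D] ij] by simp
  finally show "(kronecker A B * kronecker C D) $$ (i, j) = kronecker (A * C) (B * D) $$ (i, j)" .
qed (use assms in \<open>auto simp: kronecker_def\<close>)

lemma kronecker_one: "kronecker (1\<^sub>m m) (1\<^sub>m n) = (1\<^sub>m (m * n) :: 'a :: semiring_1 mat)"
proof (rule eq_matI)
  fix i j assume "i < dim_row (1\<^sub>m (m * n) :: 'a mat)" "j < dim_col (1\<^sub>m (m * n) :: 'a mat)"
  then have ij: "i < m * n" "j < m * n" by auto
  have "i = j \<longleftrightarrow> i div n = j div n \<and> i mod n = j mod n"
    by (metis div_mult_mod_eq)
  then show "kronecker (1\<^sub>m m) (1\<^sub>m n) $$ (i, j) = (1\<^sub>m (m * n) :: 'a mat) $$ (i, j)"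
    using ij div_mod_less[OF ij(1)] div_mod_less[OF ij(2)]
    by (simp add: kronecker_index[where m=m and n=n and k=m and l=n])
qed (auto simp: kronecker_def)

lemma mat_adjoint_index:
  fixes A :: "complex mat"
  assumes "A \<in> carrier_mat n n" "i < n" "j < n"
  shows "mat_adjoint A $$ (i, j) = cnj (A $$ (j, i))"
  using assms by (simp add: mat_adjoint_def mat_of_rows_index)

lemma mat_adjoint_carrier: "A \<in> carrier_mat n n \<Longrightarrow> mat_adjoint A \<in> carrier_mat n n"
  by (auto simp: mat_adjoint_def)

lemma kronecker_hermitian:
  fixes A B :: "complex mat"
  assumes A: "A \<in> carrier_mat m m" "mat_adjoint A = A" and B: "B \<in> carrier_mat n n" "mat_adjoint B = B"
  shows "mat_adjoint (kronecker A B) = kronecker A B"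
proof (rule eq_matI)
  note K = kronecker_carrier[OF A(1) B(1)]
  fix i j assume "i < dim_row (kronecker A B)" "j < dim_col (kronecker A B)"
  then have ij: "i < m * n" "j < m * n" using K by auto
  show "mat_adjoint (kronecker A B) $$ (i, j) = kronecker A B $$ (i, j)"
    using mat_adjoint_index[OF A(1) div_mod_less(1)[OF ij(1)] div_mod_less(1)[OF ij(2)]]
      mat_adjoint_index[OF B(1) div_mod_less(2)[OF ij(1)] div_mod_less(2)[OF ij(2)]]
    by (simp add: mat_adjoint_index[OF K ij] kronecker_index[OF A(1) B(1)] ij A(2) B(2))
qed (use mat_adjoint_carrier[OF kronecker_carrier[OF A(1) B(1)]] kronecker_carrier[OF A(1) B(1)] in auto)

lemma mat_adjoint_one: "mat_adjoint (1\<^sub>m n :: complex mat) = 1\<^sub>m n"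
proof (rule eq_matI)
  fix i j assume "i < dim_row (1\<^sub>m n :: complex mat)" "j < dim_col (1\<^sub>m n :: complex mat)"
  then show "mat_adjoint (1\<^sub>m n) $$ (i, j) = (1\<^sub>m n :: complex mat) $$ (i, j)"
    by (subst mat_adjoint_index[where n=n]) auto
qed (auto simp: mat_adjoint_def)

lemma cscalar_prod_sum: "v \<bullet>c w = (\<Sum>i<dim_vec w. v $ i * cnj (w $ i))" for v w :: "complex vec"
  by (simp add: scalar_prod_def atLeast0LessThan)

lemma hermitian_cscalar_prod:
  fixes H :: "complex mat"
  assumes H: "H \<in> carrier_mat n n" "mat_adjoint H = H" and v: "v \<in> carrier_vec n" and w: "w \<in> carrier_vec n"
  shows "(H *\<^sub>v v) \<bullet>c w = v \<bullet>c (H *\<^sub>v w)"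
proof -
  have "(H *\<^sub>v v) \<bullet>c w = (\<Sum>i<n. \<Sum>j<n. H $$ (i, j) * v $ j * cnj (w $ i))"
    using assms by (simp add: cscalar_prod_sum scalar_prod_def atLeast0LessThan sum_distrib_right)
  also have "\<dots> = (\<Sum>j<n. \<Sum>i<n. H $$ (i, j) * v $ j * cnj (w $ i))"
    by (rule sum.swap)
  also have "\<dots> = (\<Sum>j<n. \<Sum>i<n. v $ j * (cnj (H $$ (j, i)) * cnj (w $ i)))"
  proof (intro sum.cong refl)
    fix i j assume "i \<in> {..<n}" "j \<in> {..<n}"
    then have "H $$ (i, j) = cnj (H $$ (j, i))"
      using mat_adjoint_index[OF H(1), of i j] unfolding H(2) by simp
    then show "H $$ (i, j) * v $ j * cnj (w $ i) = v $ j * (cnj (H $$ (j, i)) * cnj (w $ i))"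
      by (simp only: mult_ac)
  qed
  also have "\<dots> = v \<bullet>c (H *\<^sub>v w)"
    using assms by (simp add: cscalar_prod_sum scalar_prod_def atLeast0LessThan sum_distrib_left)
  finally show ?thesis .
qed

lemma cscalar_prod_commute: "dim_vec v = dim_vec w \<Longrightarrow> cnj (v \<bullet>c w) = w \<bullet>c v" for v w :: "complex vec"
  by (simp add: cscalar_prod_sum mult.commute)

definition real_coords :: "complex vec \<Rightarrow> nat \<Rightarrow> real" where
  "real_coords v i = (if i < dim_vec v then Re (v $ i) else Im (v $ (i - dim_vec v)))"

text \<open>Termwise, \<open>Re (z * cnj w) = Re z * Re w + Im z * Im w\<close>.\<close>

lemma dot_real_coords:
  assumes "v \<in> carrier_vec N" "w \<in> carrier_vec N"
  shows "dot (N + N) (real_coords v) (real_coords w) = Re (v \<bullet>c w)"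
proof -
  let ?f = "\<lambda>i. real_coords v i * real_coords w i"
  \<comment> \<open>The second length is generalised to \<open>M\<close> so that induction can split
    the sum at \<open>N\<close>.\<close>
  have "(\<Sum>i<N + M. ?f i) = (\<Sum>i<N. ?f i) + (\<Sum>i<M. ?f (N + i))" for M
    by (induction M) (simp_all add: add.assoc)
  then have "dot (N + N) (real_coords v) (real_coords w) = (\<Sum>i<N. ?f i) + (\<Sum>i<N. ?f (N + i))"
    unfolding dot_def .
  also have "\<dots> = Re (v \<bullet>c w)"
    using assms by (simp add: real_coords_def cscalar_prod_sum sum.distrib)
  finally show ?thesis .
qed

lemma L2_set_real_coords:
  assumes "v \<in> carrier_vec N" "v \<bullet>c v = 1"
  shows "L2_set (real_coords v) {..<N + N} = 1"
proof -
  have "(L2_set (real_coords v) {..<N + N})\<^sup>2 = 1"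
    using assms by (simp add: dot_self[symmetric] dot_real_coords)
  then show ?thesis using L2_set_nonneg[of "real_coords v" "{..<N + N}"] by (simp add: power2_eq_1_iff)
qed

definition alice_vec :: "nat \<Rightarrow> complex vec \<Rightarrow> complex mat \<Rightarrow> nat \<Rightarrow> real" where
  "alice_vec d \<psi> A = real_coords (kronecker A (1\<^sub>m d) *\<^sub>v \<psi>)"

definition bob_vec :: "nat \<Rightarrow> complex vec \<Rightarrow> complex mat \<Rightarrow> nat \<Rightarrow> real" where
  "bob_vec d \<psi> B = real_coords (kronecker (1\<^sub>m d) B *\<^sub>v \<psi>)"

text \<open>The matrices \<open>U\<close> and \<open>V\<close> are Hermitian with square 1, so they
  preserve the norm of \<open>\<psi>\<close>. Their product in either order is
  \<open>kronecker A B\<close>, and moving one factor across the inner product gives the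
  correlation.\<close>

lemma correlation_vectors:
  fixes \<psi> :: "complex vec"
  assumes A: "traceless_binary_observable d A" and B: "traceless_binary_observable d B"
    and \<psi>: "\<psi> \<in> carrier_vec (d * d)" "\<psi> \<bullet>c \<psi> = 1"
  defines "n \<equiv> d * d + d * d"
  shows "L2_set (alice_vec d \<psi> A) {..<n} = 1" "L2_set (bob_vec d \<psi> B) {..<n} = 1"
    and "complex_of_real (dot n (alice_vec d \<psi> A) (bob_vec d \<psi> B)) = quantum_correlation \<psi> A B"
proof -
  note A' = A[unfolded traceless_binary_observable_def] and B' = B[unfolded traceless_binary_observable_def]
  define U V where "U = kronecker A (1\<^sub>m d)" and "V = kronecker (1\<^sub>m d) B"
  have U: "U \<in> carrier_mat (d * d) (d * d)" "mat_adjoint U = U"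
    unfolding U_def using A'
    by (auto simp: mat_adjoint_one intro!: kronecker_carrier[where m=d and k=d and n=d and l=d]
        kronecker_hermitian[where m=d and n=d])
  have V: "V \<in> carrier_mat (d * d) (d * d)" "mat_adjoint V = V"
    unfolding V_def using B'
    by (auto simp: mat_adjoint_one intro!: kronecker_carrier[where m=d and k=d and n=d and l=d]
        kronecker_hermitian[where m=d and n=d])
  have UU: "U * U = 1\<^sub>m (d * d)" and VV: "V * V = 1\<^sub>m (d * d)"
    and UV: "U * V = kronecker A B" and VU: "V * U = kronecker A B"
    unfolding U_def V_def using A' B'
    by (auto simp: kronecker_mult[where m=d and k=d and n=d and l=d and p=d and q=d] kronecker_one)
  have U\<psi>: "U *\<^sub>v \<psi> \<in> carrier_vec (d * d)" and V\<psi>: "V *\<^sub>v \<psi> \<in> carrier_vec (d * d)"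
    using U V \<psi> by auto
  have "(U *\<^sub>v \<psi>) \<bullet>c (U *\<^sub>v \<psi>) = ((U * U) *\<^sub>v \<psi>) \<bullet>c \<psi>"
    using U \<psi> U\<psi> by (simp add: hermitian_cscalar_prod[of U "d * d"])
  then show "L2_set (alice_vec d \<psi> A) {..<n} = 1"
    unfolding alice_vec_def U_def[symmetric] n_def using UU \<psi> U\<psi> by (intro L2_set_real_coords) auto
  have "(V *\<^sub>v \<psi>) \<bullet>c (V *\<^sub>v \<psi>) = ((V * V) *\<^sub>v \<psi>) \<bullet>c \<psi>"
    using V \<psi> V\<psi> by (simp add: hermitian_cscalar_prod[of V "d * d"])
  then show "L2_set (bob_vec d \<psi> B) {..<n} = 1"
    unfolding bob_vec_def V_def[symmetric] n_def using VV \<psi> V\<psi> by (intro L2_set_real_coords) auto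
  \<comment> \<open>The two orders of the product give two inner products that are conjugate to each
    other. Hence the correlation is real, and the real part computed by \<open>dot\<close> is all of
    it.\<close>
  have q1: "quantum_correlation \<psi> A B = (V *\<^sub>v \<psi>) \<bullet>c (U *\<^sub>v \<psi>)"
    unfolding quantum_correlation_def UV[symmetric] using U V \<psi> V\<psi>
    by (simp add: hermitian_cscalar_prod[of U "d * d"])
  have q2: "quantum_correlation \<psi> A B = (U *\<^sub>v \<psi>) \<bullet>c (V *\<^sub>v \<psi>)"
    unfolding quantum_correlation_def VU[symmetric] using U V \<psi> U\<psi>
    by (simp add: hermitian_cscalar_prod[of V "d * d"])
  have "cnj (quantum_correlation \<psi> A B) = quantum_correlation \<psi> A B"
    using q1 q2 cscalar_prod_commute[of "V *\<^sub>v \<psi>" "U *\<^sub>v \<psi>"] U V by simp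
  then have "complex_of_real (Re (quantum_correlation \<psi> A B)) = quantum_correlation \<psi> A B"
    by (simp add: complex_eq_iff)
  then show "complex_of_real (dot n (alice_vec d \<psi> A) (bob_vec d \<psi> B)) = quantum_correlation \<psi> A B"
    unfolding alice_vec_def bob_vec_def U_def[symmetric] V_def[symmetric] n_def
    using U\<psi> V\<psi> by (simp add: dot_real_coords q2)
qed

text \<open>The mean norm in dimension \<open>2 * d^2\<close> is at most \<open>sqrt 2 * d\<close>,
  so \<open>1 / p <= d * sqrt pi\<close>. Dividing by \<open>2 ^ L >= d\<close> leaves at most
  \<open>sqrt pi <= 2\<close>. The remaining 2 of the constant 4 are the closing bit and the
  rounding up of the logarithm.\<close>

lemma cost_bound:
  assumes "d \<ge> 1"
  defines "L \<equiv> nat \<lceil>log 2 (real d)\<rceil>"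
  shows "real L + 1 + (1 / (sqrt (2 / pi) / mean_norm (d * d + d * d))) / 2 ^ L \<le> log 2 (real d) + 4"
proof -
  have log: "log 2 (real d) \<ge> 0" using assms by simp
  have L: "real L \<le> log 2 (real d) + 1" "log 2 (real d) \<le> real L"
    using log unfolding L_def by linarith+
  have "real d = 2 powr log 2 (real d)" using assms by simp
  also have "\<dots> \<le> 2 powr real L" using L(2) by simp
  finally have d: "real d \<le> 2 ^ L" by (simp add: powr_realpow)
  have "mean_norm (d * d + d * d) \<le> sqrt (real (d * d + d * d))"
    unfolding mean_norm_def by (rule integral_L2_set_le)
  also have "\<dots> = sqrt 2 * real d"
  proof -
    have "real (d * d + d * d) = 2 * (real d)\<^sup>2" by (simp add: power2_eq_square)
    then show ?thesis by (simp add: real_sqrt_mult)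
  qed
  also have "\<dots> \<le> sqrt 2 * 2 ^ L" using d by simp
  finally have "mean_norm (d * d + d * d) / 2 ^ L \<le> sqrt 2"
    by (simp add: divide_le_eq)
  then have "mean_norm (d * d + d * d) / 2 ^ L / sqrt (2 / pi) \<le> sqrt 2 / sqrt (2 / pi)"
    by (rule divide_right_mono) simp
  also have "\<dots> = sqrt pi" by (simp add: real_sqrt_divide)
  also have "\<dots> \<le> 2" using pi_less_4 by (simp add: real_le_lsqrt)
  also have "mean_norm (d * d + d * d) / 2 ^ L / sqrt (2 / pi)
      = (1 / (sqrt (2 / pi) / mean_norm (d * d + d * d))) / 2 ^ L" by simp
  finally show ?thesis using L(1) by linarith
qed

theorem theorem6:
  shows "\<exists>C::real. C > 0 \<and>
    (\<forall>d::nat. d \<ge> 1 \<longrightarrow>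
      (\<forall>\<psi> :: complex vec. \<psi> \<in> carrier_vec (d * d) \<and> \<psi> \<bullet>c \<psi> = 1 \<longrightarrow>
        (\<exists>P :: (complex mat, complex mat, nat \<Rightarrow> real) lhv_protocol.
          valid_lhv_protocol {A. traceless_binary_observable d A}
            {B. traceless_binary_observable d B} P \<and>
          (\<forall>A B. traceless_binary_observable d A \<and> traceless_binary_observable d B \<longrightarrow>
            complex_of_real (joint_correlation P A B) = quantum_correlation \<psi> A B \<and>
            expected_bits P A B \<le> ennreal (log 2 (real d) + C)))))"
proof (intro exI[of _ "4 :: real"] conjI allI impI)
  fix d :: nat and \<psi> :: "complex vec"
  assume d: "d \<ge> 1" and \<psi>: "\<psi> \<in> carrier_vec (d * d) \<and> \<psi> \<bullet>c \<psi> = 1"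
  \<comment> \<open>The real dimension of the space that contains \<open>\<psi>\<close>.\<close>
  define n where "n = d * d + d * d"
  have n: "n > 0" using d by (simp add: n_def)
  define p where "p = sqrt (2 / pi) / mean_norm n"
  have p: "p > 0" using mean_norm_pos[OF n] by (simp add: p_def)
  let ?X = "{A. traceless_binary_observable d A}"
  note vecs = correlation_vectors[OF _ _ conjunct1[OF \<psi>] conjunct2[OF \<psi>], folded n_def]
  let ?L = "nat \<lceil>log 2 (real d)\<rceil>"
  let ?acc = "\<lambda>A. accepted n (alice_vec d \<psi> A)"
  let ?f = "\<lambda>A z. sign (dot n (alice_vec d \<psi> A) (fst z))"
  let ?g = "\<lambda>B z. sign (dot n (bob_vec d \<psi> B) (fst z))"
  have "\<exists>P :: (complex mat, complex mat, nat \<Rightarrow> real) lhv_protocol. valid_lhv_protocol ?X ?X P \<and> (\<forall>A\<in>?X. \<forall>B\<in>?X.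
      joint_correlation P A B = (\<integral>z. ?f A z * ?g B z * indicator (?acc A) z \<partial>proposal n) / p \<and>
      expected_bits P A B \<le> ennreal (real ?L + 1 + (1 / p) / 2 ^ ?L))"
  proof (rule rejection_simulation)
    show "prob_space (proposal n)" by (rule prob_space_proposal[OF n])
    show sets: "sets (proposal n) = sets (PiM UNIV (\<lambda>_. borel) \<Otimes>\<^sub>M borel)"
      unfolding proposal_def
      by (intro sets_pair_measure_cong sets_unit_interval) (simp add: sets_tilted_gauss sets_gauss_seq)
    have "(\<lambda>z. sign (dot n a (fst z))) \<in> borel_measurable (proposal n)" for a
      unfolding proposal_def by measurable
    then show "?f A \<in> borel_measurable (proposal n)" "?g B \<in> borel_measurable (proposal n)" for A B
      by auto
    show "measure (proposal n) (?acc A) = p" if "A \<in> ?X" for A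
      unfolding p_def using that by (intro measure_accepted n vecs(1)) auto
  qed (auto simp: p sign_cases[simplified])
  then obtain P :: "(complex mat, complex mat, nat \<Rightarrow> real) lhv_protocol" where P: "valid_lhv_protocol ?X ?X P"
    and corr: "\<And>A B. A \<in> ?X \<Longrightarrow> B \<in> ?X \<Longrightarrow> joint_correlation P A B
      = (\<integral>z. ?f A z * ?g B z * indicator (?acc A) z \<partial>proposal n) / p"
    and bits: "\<And>A B. A \<in> ?X \<Longrightarrow> B \<in> ?X \<Longrightarrow>
      expected_bits P A B \<le> ennreal (real ?L + 1 + (1 / p) / 2 ^ ?L)"
    by blast
  have "complex_of_real (joint_correlation P A B) = quantum_correlation \<psi> A B \<and>
      expected_bits P A B \<le> ennreal (log 2 (real d) + 4)"
    if A: "traceless_binary_observable d A" and B: "traceless_binary_observable d B" for A B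
  proof
    \<comment> \<open>Dividing by \<open>p\<close> cancels both \<open>sqrt (2 / pi)\<close> and
      \<open>mean_norm n\<close>.\<close>
    have "joint_correlation P A B = dot n (alice_vec d \<psi> A) (bob_vec d \<psi> B)"
      using corr[of A B] A B integral_sign_accepted[OF n vecs(1,2)[OF A B]] mean_norm_pos[OF n]
      by (simp add: p_def)
    then show "complex_of_real (joint_correlation P A B) = quantum_correlation \<psi> A B"
      using vecs(3)[OF A B] by simp
    have "expected_bits P A B \<le> ennreal (real ?L + 1 + (1 / p) / 2 ^ ?L)"
      using bits A B by simp
    also have "\<dots> \<le> ennreal (log 2 (real d) + 4)"
      unfolding p_def n_def by (intro ennreal_leI cost_bound d)
    finally show "expected_bits P A B \<le> ennreal (log 2 (real d) + 4)" .
  qed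
  with P show "\<exists>P :: (complex mat, complex mat, nat \<Rightarrow> real) lhv_protocol.
      valid_lhv_protocol ?X ?X P \<and>
      (\<forall>A B. traceless_binary_observable d A \<and> traceless_binary_observable d B \<longrightarrow>
        complex_of_real (joint_correlation P A B) = quantum_correlation \<psi> A B \<and>
        expected_bits P A B \<le> ennreal (log 2 (real d) + 4))"
    by blast
qed simp

end
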